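(* Let $P$ be a principal with initial trust assumptions $\mathsf T_P^0$, local-axiom schema instances $\mathsf{LAS}_P$, and set $\mathsf{TS}$ of says-statements. Let $\ell\in\widehat\Lambda$, $\ell\neq\mathsf{bound}$. If $P\text{ trusts }\langle D,O,\ell\rangle$ is derivable by repeatedly applying modus ponens and $\land$-introduction to the axioms, the instances of the local axiom schemata in $\mathsf{LAS}_P$, the elements of $\mathsf{TS}$, and the elements of $\mathsf T_P^0$, then one of the following conditions holds: 1. $P\text{ trusts }\langle D,O,\widetilde\ell\rangle$ is in $\mathsf T_P^0$ for some $\widetilde\ell\preceq\ell$; or 2. for some $g\in\widehat\Gamma$ and $\widetilde\ell\preceq\ell$: (a) $\mathsf{DEL}(g,\widetilde\ell)\in\mathsf{LAS}_P$; and (b) $P\text{ trusts }\langle D,O,g\rangle$ is derivable; or 3. for some $(D',O')$ and some $\widehat\ell$ and $\widetilde\ell$ such that $\widehat\ell\succeq\widetilde\ell\preceq\ell$: (a) $P\text{ trusts }\langle D',O',\mathsf{sattestor}(\widehat\ell)\rangle$ is derivable; and (b) $P\text{ trusts }(D',O')\text{ says }\langle D,O,\widetilde\ell\rangle$ is derivable.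
   Context: **Labels.** $\widehat\Lambda$ is a set of (sattestor-free) labels with a partial order $\prec$ ($\ell_1\prec\ell_2$: "$\ell_1$ narrows $\ell_2$", "$\ell_2$ broadens $\ell_1$"); $\preceq,\succ,\succeq$ are the derived relations. It contains a distinguished label $\mathsf{bound}$, incomparable to every other label. For every $\ell$ the set $\{\ell':\ell'\succeq\ell\}$ is finite and linearly ordered. $\widehat\Gamma=\widehat\Lambda\cup\{\mathsf{sattestor}(\ell):\ell\in\widehat\Lambda\}\cup\{\mathsf{sattestor}^*(\ell):\ell\in\widehat\Lambda\}$ (formal, distinct expressions). $\ell$'s range over $\widehat\Lambda$, $g$'s over $\widehat\Gamma$. **Language.** $D$ ranges over domain names, $O$ over onion addresses. A principal is an element of a set $\mathcal P$, or $\langle D,O\rangle$, or a pair $(D,O)$. A bound labeled pair is $\langle D,O\rangle$ (synonymous with $\langle D,O,\mathsf{bound}\rangle$) or $\langle D,O,g\rangle$. A says-statement is $(D,O)\text{ says }\pi$, $\pi$ a bound labeled pair. A trust statement is $P\text{ trusts }\chi$, $\chi$ a says-statement or bound labeled pair. Statements are the pairs $\langle D,O\rangle$/$\langle D,O,\mathsf{bound}\rangle$, says-statements, trust statements, and order statements $\ell\preceq\ell'$ (also written $\ell'\succeq\ell$). Formulae are built from statements with $\rightarrow$ and $\land$. **Axioms** (all instances): - A1: $(\ell_1\succeq\ell_2 \land P\text{ trusts }\langle D,O,\ell_2\rangle)\rightarrow P\text{ trusts }\langle D,O,\ell_1\rangle$. - A2: $(\ell_1\succeq\ell_2\succeq\ell_3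 \land P\text{ trusts }\langle D_1,O_1,\mathsf{sattestor}(\ell_1)\rangle \land P\text{ trusts }(D_1,O_1)\text{ says }\langle D_2,O_2,\ell_2\rangle \land P\text{ trusts }(D_2,O_2)\text{ says }\langle D_2,O_2,\ell_3\rangle)\rightarrow P\text{ trusts }\langle D_2,O_2,\ell_2\rangle$. - A3: $(\ell_1\succeq\ell_2\succeq\ell_3 \land P\text{ trusts }\langle D_1,O_1,\mathsf{sattestor}^*(\ell_1)\rangle \land P\text{ trusts }(D_1,O_1)\text{ says }\langle D_2,O_2,\mathsf{sattestor}^*(\ell_2)\rangle \land P\text{ trusts }(D_2,O_2)\text{ says }\langle D_3,O_3,\mathsf{sattestor}(\ell_3)\rangle)\rightarrow P\text{ trusts }\langle D_2,O_2,\mathsf{sattestor}^*(\ell_3)\rangle$. - A4: $(\ell_1\succeq\ell_2\succeq\ell_3 \land P\text{ trusts }\langle D_1,O_1,\mathsf{sattestor}^*(\ell_1)\rangle \land P\text{ trusts }(D_1,O_1)\text{ says }\langle D_2,O_2,\mathsf{sattestor}(\ell_2)\rangle \land P\text{ trusts }(D_2,O_2)\text{ says }\langle D_3,O_3,\ell_3\rangle)\rightarrow P\text{ trusts }\langle D_2,O_2,\mathsf{sattestor}(\ell_3)\rangle$. - A5: $P\text{ trusts }\langle D,O,g\rangle\rightarrow P\text{ trusts }\langle D,O,\mathsf{bound}\rangle$. - A6: $(P\text{ trusts }(D,O)\text{ says }\varphi)\rightarrow (P\text{ trusts }(D,O)\text{ says }\langle D,O,\mathsf{bound}\rangle)$.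 - A7: $P\text{ trusts }\langle D,O,\mathsf{sattestor}^*(\ell)\rangle\rightarrow P\text{ trusts }\langle D,O,\mathsf{sattestor}(\ell)\rangle$. - A8: $P\text{ trusts }(D_1,O_1)\text{ says }\langle D_2,O_2,\mathsf{sattestor}^*(\ell)\rangle\rightarrow P\text{ trusts }(D_1,O_1)\text{ says }\langle D_2,O_2,\mathsf{sattestor}(\ell)\rangle$. - A9: $(\ell_1\succeq\ell_2\land P\text{ trusts }\langle D,O,\mathsf{sattestor}(\ell_1)\rangle)\rightarrow P\text{ trusts }\langle D,O,\mathsf{sattestor}(\ell_2)\rangle$. - A10: $(\ell_1\succeq\ell_2\land P\text{ trusts }\langle D,O,\mathsf{sattestor}^*(\ell_1)\rangle)\rightarrow P\text{ trusts }\langle D,O,\mathsf{sattestor}^*(\ell_2)\rangle$. - A11: $(D,O)\text{ says }\varphi\rightarrow (P\text{ trusts }(D,O)\text{ says }\varphi)$. - A12: (a) $(\varphi\land\psi)\rightarrow\varphi$; (b) $(\varphi\land\psi)\rightarrow(\psi\land\varphi)$; (c) $(\varphi\land(\psi\land\delta))\rightarrow((\varphi\land\psi)\land\delta)$. **Local axiom schemata** for $P$: - $\mathsf{DEL}(g_1,g_2)$: $P\text{ trusts }\langle D,O,g_1\rangle\rightarrow P\text{ trusts }\langle D,O,g_2\rangle$, for the given $g_1,g_2$ and any $D,O$. - $\mathsf{SATT}(D,O)$: $P\text{ trusts }\langle D,O,\mathsf{sattestor}(\ell)\rangle$, for the given $D,O$ and all labels $\ell$. - $\mathsf{SATT}^*(D,O)$: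 $P\text{ trusts }\langle D,O,\mathsf{sattestor}^*(\ell)\rangle$, for the given $D,O$ and all labels $\ell$. **Rules.** Modus ponens (from $\varphi$ and $\varphi\rightarrow\psi$ infer $\psi$) and $\land$-introduction (from $\varphi$ and $\psi$ infer $\varphi\land\psi$). **Setting.** $\mathsf T_P^0$ is a set of trust statements of the form $P\text{ trusts }X$; $\mathsf{LAS}_P$ is a set of instances $\mathsf{DEL}(g_1,g_2)$, $\mathsf{SATT}(D,O)$, $\mathsf{SATT}^*(D,O)$; $\mathsf{TS}$ is a set of says-statements. "Derivable" always means derivable by modus ponens and $\land$-introduction from the axioms, $\mathsf{LAS}_P$, $\mathsf{TS}$ and $\mathsf T_P^0$, with the true facts $\ell\preceq\ell'$ about the label order also available as assumptions. All elements of these sets are conjunction-free, and derivations are assumed not to contain applications of modus ponens to axiom A12(a). *)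

theory Defs
  imports Main
begin

text \<open>The type of labels is an instance of \<open>label\<close>; \<open>l1 \<le> l2\<close> renders ``l1 narrows or equals l2''.\<close>

class label = order +
  fixes bound :: 'a
  assumes bound_incomparable: "l \<noteq> bound \<Longrightarrow> \<not> l \<le> bound \<and> \<not> bound \<le> l"
    and finite_broader: "finite {l'. l \<le> l'}"
    and linear_broader: "l \<le> l1 \<Longrightarrow> l \<le> l2 \<Longrightarrow> l1 \<le> l2 \<or> l2 \<le> l1"

datatype 'l glabel = Lab 'l | Sattestor 'l | SattestorStar 'l

text \<open>The type parameters \<open>'d\<close>, \<open>'o\<close>, \<open>'p\<close> are the domain names, the onion addresses and the set of
  basic principals. Variables for onion addresses are called \<open>A\<close>, since \<open>O\<close> is relation composition.
  A pair without a label is the pair with label \<open>bound\<close>.\<close>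

datatype ('d, 'o, 'p) principal =
    Basic 'p
  | BoundPrincipal 'd 'o  \<comment> \<open>angle brackets\<close>
  | PairPrincipal 'd 'o   \<comment> \<open>round brackets\<close>

datatype ('d, 'o, 'l) labeled_pair = LPair 'd 'o "'l glabel"  (\<open>\<langle>_, _, _\<rangle>\<close>)

datatype ('d, 'o, 'l) says_stmt =
  Says 'd 'o "('d, 'o, 'l) labeled_pair"  (\<open>'(_, _') says _\<close> [0, 0, 61] 61)

datatype ('d, 'o, 'l) trust_object =
    ObjPair "('d, 'o, 'l) labeled_pair"
  | ObjSays "('d, 'o, 'l) says_stmt"

datatype ('d, 'o, 'l, 'p) trust_stmt =
  Trusts "('d, 'o, 'p) principal" "('d, 'o, 'l) trust_object"

datatype ('d, 'o, 'l, 'p) stmt =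
    BoundStmt 'd 'o  \<comment> \<open>only pairs with label \<open>bound\<close> are statements by themselves\<close>
  | SaysStmt "('d, 'o, 'l) says_stmt"
  | TrustStmt "('d, 'o, 'l, 'p) trust_stmt"
  | OrderStmt 'l 'l  \<comment> \<open>the formal statement that the first label is below the second\<close>

datatype ('d, 'o, 'l, 'p) formula =
    Stmt "('d, 'o, 'l, 'p) stmt"
  | Imp "('d, 'o, 'l, 'p) formula" "('d, 'o, 'l, 'p) formula"  (infixr \<open>\<^bold>\<longrightarrow>\<close> 25)
  | Conj "('d, 'o, 'l, 'p) formula" "('d, 'o, 'l, 'p) formula"  (infixr \<open>\<^bold>\<and>\<close> 35)

abbreviation trusts_pair ::
    "('d, 'o, 'p) principal \<Rightarrow> ('d, 'o, 'l) labeled_pair \<Rightarrow> ('d, 'o, 'l, 'p) formula"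
    (infix \<open>trusts\<close> 60)
  where "P trusts \<pi> \<equiv> Stmt (TrustStmt (Trusts P (ObjPair \<pi>)))"

abbreviation trusts_says ::
    "('d, 'o, 'p) principal \<Rightarrow> ('d, 'o, 'l) says_stmt \<Rightarrow> ('d, 'o, 'l, 'p) formula"
    (infix \<open>trusts\<^sub>s\<close> 60)
  where "P trusts\<^sub>s s \<equiv> Stmt (TrustStmt (Trusts P (ObjSays s)))"

abbreviation broader :: "'l \<Rightarrow> 'l \<Rightarrow> ('d, 'o, 'l, 'p) formula"  (infix \<open>\<^bold>\<ge>\<close> 60)
  where "l1 \<^bold>\<ge> l2 \<equiv> Stmt (OrderStmt l2 l1)"

text \<open>A chain \<open>l1 \<succeq> l2 \<succeq> l3\<close> is the conjunction of its two order statements. Iterated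
  conjunctions associate to the right.\<close>

inductive_set A12a :: "('d, 'o, 'l, 'p) formula set" where
  "(\<phi> \<^bold>\<and> \<psi> \<^bold>\<longrightarrow> \<phi>) \<in> A12a"

inductive_set axioms :: "('d, 'o, 'l::label, 'p) formula set" where
  A1: "(l1 \<^bold>\<ge> l2 \<^bold>\<and> P trusts \<langle>D, A, Lab l2\<rangle> \<^bold>\<longrightarrow> P trusts \<langle>D, A, Lab l1\<rangle>) \<in> axioms"
| A2: "((l1 \<^bold>\<ge> l2 \<^bold>\<and> l2 \<^bold>\<ge> l3) \<^bold>\<and> P trusts \<langle>D1, A1, Sattestor l1\<rangle>
        \<^bold>\<and> P trusts\<^sub>s (D1, A1) says \<langle>D2, A2, Lab l2\<rangle>
        \<^bold>\<and> P trusts\<^sub>s (D2, A2) says \<langle>D2, A2, Lab l3\<rangle>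
        \<^bold>\<longrightarrow> P trusts \<langle>D2, A2, Lab l2\<rangle>) \<in> axioms"
| A3: "((l1 \<^bold>\<ge> l2 \<^bold>\<and> l2 \<^bold>\<ge> l3) \<^bold>\<and> P trusts \<langle>D1, A1, SattestorStar l1\<rangle>
        \<^bold>\<and> P trusts\<^sub>s (D1, A1) says \<langle>D2, A2, SattestorStar l2\<rangle>
        \<^bold>\<and> P trusts\<^sub>s (D2, A2) says \<langle>D3, A3, Sattestor l3\<rangle>
        \<^bold>\<longrightarrow> P trusts \<langle>D2, A2, SattestorStar l3\<rangle>) \<in> axioms"
| A4: "((l1 \<^bold>\<ge> l2 \<^bold>\<and> l2 \<^bold>\<ge> l3) \<^bold>\<and> P trusts \<langle>D1, A1, SattestorStar l1\<rangle>
        \<^bold>\<and> P trusts\<^sub>s (D1, A1) says \<langle>D2, A2, Sattestor l2\<rangle>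
        \<^bold>\<and> P trusts\<^sub>s (D2, A2) says \<langle>D3, A3, Lab l3\<rangle>
        \<^bold>\<longrightarrow> P trusts \<langle>D2, A2, Sattestor l3\<rangle>) \<in> axioms"
| A5: "(P trusts \<langle>D, A, g\<rangle> \<^bold>\<longrightarrow> P trusts \<langle>D, A, Lab bound\<rangle>) \<in> axioms"
| A6: "(P trusts\<^sub>s (D, A) says \<pi> \<^bold>\<longrightarrow> P trusts\<^sub>s (D, A) says \<langle>D, A, Lab bound\<rangle>) \<in> axioms"
| A7: "(P trusts \<langle>D, A, SattestorStar l\<rangle> \<^bold>\<longrightarrow> P trusts \<langle>D, A, Sattestor l\<rangle>) \<in> axioms"
| A8: "(P trusts\<^sub>s (D1, A1) says \<langle>D2, A2, SattestorStar l\<rangle>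
        \<^bold>\<longrightarrow> P trusts\<^sub>s (D1, A1) says \<langle>D2, A2, Sattestor l\<rangle>) \<in> axioms"
| A9: "(l1 \<^bold>\<ge> l2 \<^bold>\<and> P trusts \<langle>D, A, Sattestor l1\<rangle>
        \<^bold>\<longrightarrow> P trusts \<langle>D, A, Sattestor l2\<rangle>) \<in> axioms"
| A10: "(l1 \<^bold>\<ge> l2 \<^bold>\<and> P trusts \<langle>D, A, SattestorStar l1\<rangle>
        \<^bold>\<longrightarrow> P trusts \<langle>D, A, SattestorStar l2\<rangle>) \<in> axioms"
| A11: "(Stmt (SaysStmt ((D, A) says \<pi>)) \<^bold>\<longrightarrow> P trusts\<^sub>s (D, A) says \<pi>) \<in> axioms"
| A12a: "\<phi> \<in> A12a \<Longrightarrow> \<phi> \<in> axioms"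
| A12b: "(\<phi> \<^bold>\<and> \<psi> \<^bold>\<longrightarrow> \<psi> \<^bold>\<and> \<phi>) \<in> axioms"
| A12c: "(\<phi> \<^bold>\<and> (\<psi> \<^bold>\<and> \<delta>) \<^bold>\<longrightarrow> (\<phi> \<^bold>\<and> \<psi>) \<^bold>\<and> \<delta>) \<in> axioms"

datatype ('d, 'o, 'l) local_schema =
    DEL "'l glabel" "'l glabel"
  | SATT 'd 'o
  | SATTStar 'd 'o

inductive_set local_axioms ::
    "('d, 'o, 'p) principal \<Rightarrow> ('d, 'o, 'l) local_schema set \<Rightarrow> ('d, 'o, 'l, 'p) formula set"
  for P and LAS where
  DEL: "DEL g1 g2 \<in> LAS
    \<Longrightarrow> (P trusts \<langle>D, A, g1\<rangle> \<^bold>\<longrightarrow> P trusts \<langle>D, A, g2\<rangle>) \<in> local_axioms P LAS"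
| SATT: "SATT D A \<in> LAS \<Longrightarrow> (P trusts \<langle>D, A, Sattestor l\<rangle>) \<in> local_axioms P LAS"
| SATTStar: "SATTStar D A \<in> LAS
    \<Longrightarrow> (P trusts \<langle>D, A, SattestorStar l\<rangle>) \<in> local_axioms P LAS"

text \<open>Derivations contain no application of modus ponens whose implication is an instance of
  axiom A12(a); the side condition of \<open>mp\<close> expresses this.\<close>

inductive derivable ::
    "('d, 'o, 'p) principal \<Rightarrow> ('d, 'o, 'l::label) local_schema set \<Rightarrow> ('d, 'o, 'l) says_stmt set
      \<Rightarrow> ('d, 'o, 'l, 'p) trust_stmt set \<Rightarrow> ('d, 'o, 'l, 'p) formula \<Rightarrow> bool"
  for P LAS TS T0 where
  ax: "\<phi> \<in> axioms \<Longrightarrow> derivable P LAS TS T0 \<phi>"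
| local_ax: "\<phi> \<in> local_axioms P LAS \<Longrightarrow> derivable P LAS TS T0 \<phi>"
| says: "s \<in> TS \<Longrightarrow> derivable P LAS TS T0 (Stmt (SaysStmt s))"
| trust: "t \<in> T0 \<Longrightarrow> derivable P LAS TS T0 (Stmt (TrustStmt t))"
| order: "l1 \<le> l2 \<Longrightarrow> derivable P LAS TS T0 (Stmt (OrderStmt l1 l2))"
| mp: "derivable P LAS TS T0 \<phi> \<Longrightarrow> derivable P LAS TS T0 (\<phi> \<^bold>\<longrightarrow> \<psi>)
    \<Longrightarrow> (\<phi> \<^bold>\<longrightarrow> \<psi>) \<notin> A12a \<Longrightarrow> derivable P LAS TS T0 \<psi>"
| conjI: "derivable P LAS TS T0 \<phi> \<Longrightarrow> derivable P LAS TS T0 \<psi>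
    \<Longrightarrow> derivable P LAS TS T0 (\<phi> \<^bold>\<and> \<psi>)"

end

(* Without A12(a) in modus ponens, a derived implication is an axiom or a local axiom. Hence every
   conjunct of a derived formula is itself derivable, and by induction on the derivation trust in a
   label other than bound comes from T0, from DEL, from A2, or through A1 from trust in a narrower
   label; each of the three conditions is inherited by broader labels. *)

theory Submission
  imports Defs
begin

definition label_supported where
  "label_supported P LAS TS T0 D A l \<longleftrightarrow>
    (\<exists>l'. l' \<le> l \<and> Trusts P (ObjPair \<langle>D, A, Lab l'\<rangle>) \<in> T0)
    \<or> (\<exists>g l'. l' \<le> l \<and> DEL g (Lab l') \<in> LAS
          \<and> derivable P LAS TS T0 (P trusts \<langle>D, A, g\<rangle>))
    \<or> (\<exists>D' A' l'' l'. l'' \<ge> l' \<and> l' \<le> l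
          \<and> derivable P LAS TS T0 (P trusts \<langle>D', A', Sattestor l''\<rangle>)
          \<and> derivable P LAS TS T0 (P trusts\<^sub>s (D', A') says \<langle>D, A, Lab l'\<rangle>))"

lemma label_supported_mono:
  "label_supported P LAS TS T0 D A l \<Longrightarrow> l \<le> k \<Longrightarrow> label_supported P LAS TS T0 D A k"
  unfolding label_supported_def by (meson order_trans)

text \<open>Needed for \<open>A1\<close>: a label below one that differs from \<open>bound\<close>
  differs from \<open>bound\<close> too, so the induction hypothesis applies to the trust
  premise.\<close>

lemma bound_le_iff: "bound \<le> l \<longleftrightarrow> l = (bound :: 'l::label)"
  using bound_incomparable by blast

text \<open>The induction invariant. Order statements must be true, so that the premises of
  \<open>A1\<close> and \<open>A2\<close> give actual comparisons of labels. Implications are tied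
  to the axiom sets, so that modus ponens becomes a case distinction. The label \<open>bound\<close>
  is exempt because \<open>A5\<close> yields trust in it from trust in any \<open>g\<close>.\<close>

primrec conjuncts_supported where
  "conjuncts_supported P LAS TS T0 (Stmt s) \<longleftrightarrow> derivable P LAS TS T0 (Stmt s)
    \<and> (\<forall>l1 l2. s = OrderStmt l1 l2 \<longrightarrow> l1 \<le> l2)
    \<and> (\<forall>D A l. s = TrustStmt (Trusts P (ObjPair \<langle>D, A, Lab l\<rangle>)) \<longrightarrow> l \<noteq> bound
          \<longrightarrow> label_supported P LAS TS T0 D A l)"
| "conjuncts_supported P LAS TS T0 (\<phi> \<^bold>\<longrightarrow> \<psi>) \<longleftrightarrow>
    (\<phi> \<^bold>\<longrightarrow> \<psi>) \<in> axioms \<union> local_axioms P LAS"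
| "conjuncts_supported P LAS TS T0 (\<phi> \<^bold>\<and> \<psi>) \<longleftrightarrow>
    conjuncts_supported P LAS TS T0 \<phi> \<and> conjuncts_supported P LAS TS T0 \<psi>"

lemma conjuncts_supported_axiom:
  assumes "\<phi> \<in> axioms"
  shows "conjuncts_supported P LAS TS T0 \<phi>"
  using assms by (cases rule: axioms.cases) (auto intro: axioms.intros axioms.A12a[OF A12a.intros] elim!: A12a.cases)

text \<open>\<open>DEL\<close> instances fall under the clause for implications. \<open>SATT\<close>
  and \<open>SATTStar\<close> instances carry no plain label, which leaves only their
  derivability.\<close>

lemma conjuncts_supported_local_axiom:
  assumes "\<phi> \<in> local_axioms P LAS"
  shows "conjuncts_supported P LAS TS T0 \<phi>"
  using assms
  by (cases rule: local_axioms.cases)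
    (auto intro: local_axioms.intros derivable.local_ax)

lemma conjuncts_supported_mp_axiom:
  assumes "(\<phi> \<^bold>\<longrightarrow> \<psi>) \<in> axioms"
    and "(\<phi> \<^bold>\<longrightarrow> \<psi>) \<notin> A12a"
    and "conjuncts_supported P LAS TS T0 \<phi>"
    and "derivable P LAS TS T0 \<psi>"
  shows "conjuncts_supported P LAS TS T0 \<psi>"
  using assms(1)
proof (cases rule: axioms.cases)
  case (A1 l1 l2 Q D A)
  then show ?thesis
    using assms(3,4) by (auto simp: bound_le_iff intro: label_supported_mono)
next
  \<comment> \<open>The third alternative holds with \<open>(D1, A1)\<close> as attestor,
    \<open>l1\<close> for \<open>l''\<close> and \<open>l2\<close> itself for
    \<open>l'\<close>.\<close>
  case (A2 l1 l2 l3 Q D1 A1 D2 A2)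
  then show ?thesis
    using assms(3,4) by (auto simp: label_supported_def)
\<comment> \<open>None of \<open>A3\<close> to \<open>A11\<close> concludes
  \<open>P trusts \<langle>D, A, Lab l\<rangle>\<close> with \<open>l\<close> other than
  \<open>bound\<close>. \<open>A12b\<close> and \<open>A12c\<close> only rearrange conjuncts already
  covered, and \<open>A12a\<close> contradicts the second assumption.\<close>
qed (use assms(2-4) in auto)

text \<open>Only \<open>DEL\<close> gives an implication. Its derivable premise is the second
  alternative, with \<open>g1\<close> for \<open>g\<close> and the concluded label for
  \<open>l'\<close>.\<close>

lemma conjuncts_supported_mp_local_axiom:
  assumes "(\<phi> \<^bold>\<longrightarrow> \<psi>) \<in> local_axioms P LAS"
    and "derivable P LAS TS T0 \<phi>"
    and "derivable P LAS TS T0 \<psi>"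
  shows "conjuncts_supported P LAS TS T0 \<psi>"
  using assms(1) by cases (use assms(2,3) in \<open>auto simp: label_supported_def\<close>)

lemma derivable_conjuncts_supported:
  assumes "derivable P LAS TS T0 \<phi>"
  shows "conjuncts_supported P LAS TS T0 \<phi>"
  using assms
proof induction
  case (ax \<phi>)
  then show ?case by (rule conjuncts_supported_axiom)
next
  case (local_ax \<phi>)
  then show ?case by (rule conjuncts_supported_local_axiom)
next
  case (says s)
  then show ?case by (auto intro: derivable.says)
next
  case (trust t)
  \<comment> \<open>The first alternative holds with the label itself for \<open>l'\<close>.\<close>
  then show ?case by (auto simp: label_supported_def intro: derivable.trust)
next
  case (order l1 l2)
  then show ?case by (auto intro: derivable.order)
next
  case (mp \<phi> \<psi>)
  \<comment> \<open>The invariant at a statement includes its derivability, which here comes from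
    the rule and not from the induction hypotheses.\<close>
  have "derivable P LAS TS T0 \<psi>"
    using mp.hyps by (rule derivable.mp)
  with mp show ?case
    by (auto intro: conjuncts_supported_mp_axiom conjuncts_supported_mp_local_axiom)
next
  case (conjI \<phi> \<psi>)
  then show ?case by simp
qed

theorem mainTheorem4:
  fixes P :: "('d, 'o, 'p) principal"
    and LAS :: "('d, 'o, 'l::label) local_schema set"
    and TS :: "('d, 'o, 'l) says_stmt set"
    and T0 :: "('d, 'o, 'l, 'p) trust_stmt set"
    and l :: 'l and D :: 'd and A :: 'o
  assumes "T0 \<subseteq> {Trusts P \<chi> | \<chi>. True}"
    and "l \<noteq> bound"
    and "derivable P LAS TS T0 (P trusts \<langle>D, A, Lab l\<rangle>)"
  shows "(\<exists>l'. l' \<le> l \<and> Trusts P (ObjPair \<langle>D, A, Lab l'\<rangle>) \<in> T0)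
    \<or> (\<exists>g l'. l' \<le> l \<and> DEL g (Lab l') \<in> LAS
          \<and> derivable P LAS TS T0 (P trusts \<langle>D, A, g\<rangle>))
    \<or> (\<exists>D' A' l'' l'. l'' \<ge> l' \<and> l' \<le> l
          \<and> derivable P LAS TS T0 (P trusts \<langle>D', A', Sattestor l''\<rangle>)
          \<and> derivable P LAS TS T0 (P trusts\<^sub>s (D', A') says \<langle>D, A, Lab l'\<rangle>))"
  using derivable_conjuncts_supported[OF assms(3)] assms(2)
  by (simp add: label_supported_def)

end
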